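(* Let $K$ be a totally real number field, and suppose there is a prime $\mathfrak{p}$ of its ring of integers $\mathcal{O}_K$ lying over the ideal $(3)$ with residue degree $1$. Fix a real embedding $K\hookrightarrow\mathbb{R}$ and let $|\cdot|$ be the induced absolute value. Let $f(x)=(x-\gamma)^2+\gamma+m$, where $$m=-1-2k^2+k^4,\qquad \gamma=1+k^2(-2+k^2)(-1-4k^2+2k^4)(1-4k^2+2k^4)$$ for $k\in\mathcal{O}_K$. If $|k|>\sqrt{2}$ and $\mathfrak{p}\nmid (k)$, then $f$ has a newly reducible third iterate over $K$. In particular, $K\in\mathcal{N}_{2,3}^\infty$.
   Context: $f^i$ denotes the $i$-th iterate of $f$ under composition. $f$ has a newly reducible third iterate over $K$ if $f^2$ is irreducible over $K$ but $f^3$ is not irreducible over $K$. $K\in\mathcal{N}_{2,3}^\infty$ means that there are infinitely many $f\in K[x]$ of degree $2$ with newly reducible third iterate over $K$. *)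

theory Defs
  imports "HOL-Algebra.Embedded_Algebras" "HOL-Computational_Algebra.Polynomial" Complex_Main
begin

text \<open>
  A number field is a type of class \<open>field_char_0\<close> that is finite-dimensional as a vector
  space over the rationals.
\<close>

definition number_field :: "'a::field_char_0 itself \<Rightarrow> bool" where
  "number_field _ \<longleftrightarrow>
     (\<exists>B :: 'a set. finite B \<and> module.span (\<lambda>(q::rat) x. of_rat q * x) B = UNIV)"

text \<open>Unital ring homomorphisms between fields; injectivity is automatic.\<close>

definition field_embedding :: "('a::field \<Rightarrow> 'b::field) \<Rightarrow> bool" where
  "field_embedding \<sigma> \<longleftrightarrow> \<sigma> 1 = 1 \<and> (\<forall>x y. \<sigma> (x + y) = \<sigma> x + \<sigma> y) \<and> (\<forall>x y. \<sigma> (x * y) = \<sigma> x * \<sigma> y)"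

definition totally_real :: "'a::field_char_0 itself \<Rightarrow> bool" where
  "totally_real _ \<longleftrightarrow> (\<forall>\<sigma> :: 'a \<Rightarrow> complex. field_embedding \<sigma> \<longrightarrow> range \<sigma> \<subseteq> \<real>)"

definition ring_of_integers :: "'a::field_char_0 ring" where
  "ring_of_integers =
     \<lparr>carrier = {x. algebraic_int x}, monoid.mult = (*), one = 1, ring.zero = 0, add = (+)\<rparr>"

text \<open>The contraction of \<open>P\<close> to the integers is the ideal \<open>(p)\<close>.\<close>

definition lies_over :: "'a::field_char_0 set \<Rightarrow> int \<Rightarrow> bool" where
  "lies_over P p \<longleftrightarrow> {n :: int. of_int n \<in> P} = {n. p dvd n}"

abbreviation residue_ring_of :: "'a::field_char_0 set \<Rightarrow> 'a set ring" where
  "residue_ring_of P \<equiv> ring_of_integers Quot P"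

text \<open>
  The image of the integers in the quotient by \<open>P\<close>.  If \<open>P\<close> is a prime ideal lying over
  \<open>(p)\<close> for a prime number \<open>p\<close>, this is the copy of the field of \<open>p\<close> elements over
  which the residue degree is taken.
\<close>

definition residue_prime_field :: "'a::field_char_0 set \<Rightarrow> 'a set set" where
  "residue_prime_field P = range (\<lambda>n::int. P +>\<^bsub>ring_of_integers\<^esub> of_int n)"

definition has_residue_degree :: "'a::field_char_0 set \<Rightarrow> nat \<Rightarrow> bool" where
  "has_residue_degree P d \<longleftrightarrow>
     ring.dimension (residue_ring_of P) d (residue_prime_field P) (carrier (residue_ring_of P))"

text \<open>Divisibility of ideals of a ring of integers: to divide is to contain.\<close>

definition ideal_dvd :: "'a set \<Rightarrow> 'a set \<Rightarrow> bool" where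
  "ideal_dvd I J \<longleftrightarrow> J \<subseteq> I"

definition poly_iterate :: "nat \<Rightarrow> 'a::comm_semiring_1 poly \<Rightarrow> 'a poly" where
  "poly_iterate n f = ((\<lambda>g. pcompose f g) ^^ n) [:0, 1:]"

definition newly_reducible_iterate :: "nat \<Rightarrow> 'a::field poly \<Rightarrow> bool" where
  "newly_reducible_iterate n f \<longleftrightarrow>
     Factorial_Ring.irreducible (poly_iterate (n - 1) f) \<and>
     \<not> Factorial_Ring.irreducible (poly_iterate n f)"

text \<open>Membership of the field in the class \<open>N\<^sub>d\<^sub>,\<^sub>n\<^sup>\<infinity>\<close>.\<close>

definition in_N_infinity :: "'a::field itself \<Rightarrow> nat \<Rightarrow> nat \<Rightarrow> bool" where
  "in_N_infinity _ d n \<longleftrightarrow>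
     infinite {f :: 'a poly. Polynomial.degree f = d \<and> newly_reducible_iterate n f}"

definition coeff_m :: "'a::field \<Rightarrow> 'a" where
  "coeff_m k = - 1 - 2 * k^2 + k^4"

definition coeff_gamma :: "'a::field \<Rightarrow> 'a" where
  "coeff_gamma k = 1 + k^2 * (- 2 + k^2) * (- 1 - 4 * k^2 + 2 * k^4) * (1 - 4 * k^2 + 2 * k^4)"

definition quad_poly :: "'a::field \<Rightarrow> 'a poly" where
  "quad_poly k = [:- coeff_gamma k, 1:]^2 + [:coeff_gamma k + coeff_m k:]"

end

theory Submission
  imports Defs "HOL-Computational_Algebra.Fundamental_Theorem_Algebra"
begin

text \<open>
  Put \<open>v = k\<^sup>4 - 2 k\<^sup>2\<close>.  The parameters are chosen so that \<open>m = v - 1\<close> and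
  \<open>\<gamma> + m = 4 v\<^sup>3\<close>, while \<open>v + 1 = (k\<^sup>2 - 1)\<^sup>2\<close> is a square.  In the variable \<open>Y = X - \<gamma>\<close>
  the iterates of \<open>f\<close> become even polynomials in \<open>Y\<close>.

  The third iterate is the difference of the squares of an even and an odd polynomial in \<open>Y\<close>, for every
  \<open>k\<close>, and therefore factors as \<open>h(Y) h(-Y)\<close> (\<open>quad_poly_iterate3\<close>).

  The second iterate is \<open>Y\<^sup>4 + 2 m Y\<^sup>2 + m\<^sup>2 + 4 v\<^sup>3\<close>.  Such a biquadratic polynomial is
  irreducible when neither \<open>- 4 v\<^sup>3\<close> nor \<open>m\<^sup>2 + 4 v\<^sup>3\<close> is a square
  (\<open>biquadratic_irreducible\<close>).  The first is negative in the real embedding because \<open>k\<^sup>2 > 2\<close>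
  there.  The second is \<open>(v + 1) (4 v\<^sup>2 - 3 v + 1)\<close>, a nonzero square times
  \<open>4 v\<^sup>2 - 3 v + 1\<close>.  Residue degree 1 over 3 says that every algebraic integer is congruent to a
  rational integer modulo the prime ideal, so \<open>v \<equiv> -1\<close> when \<open>k\<close> is outside of it, and
  \<open>4 v\<^sup>2 - 3 v + 1\<close> is congruent to 2, a nonsquare (\<open>quadratic_nonsquare\<close>).

  For the infinite family \<open>k\<close> runs through natural numbers prime to 3.  This needs one real embedding of
  the field.  A number field has a complex embedding, obtained by extending the inclusion of the rationals
  over the elements of a finite spanning set (\<open>number_field_complex_embedding\<close>), and in a totally real
  field it takes real values.
\<close>

section \<open>Irreducibility of biquadratic polynomials\<close>

text \<open>
  Substituting \<open>X + c\<close> is an automorphism of the polynomial ring with inverse the substitution of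
  \<open>X - c\<close>, so a factorisation of the shifted polynomial can be shifted back.
\<close>

lemma irreducible_pcompose_linear_shift:
  fixes p :: "'a::field poly"
  assumes "Factorial_Ring.irreducible p"
  shows "Factorial_Ring.irreducible (pcompose p [:c, 1:])"
proof (rule Factorial_Ring.irreducibleI)
  have inverse_shift: "pcompose (pcompose q [:c, 1:]) [:-c, 1:] = q" for q :: "'a poly"
    by (simp flip: pcompose_assoc add: pcompose_pCons)
  show "pcompose p [:c, 1:] \<noteq> 0"
    using assms by (auto simp: pcompose_eq_0_iff)
  show "\<not> pcompose p [:c, 1:] dvd 1"
    using assms by (auto simp: Factorial_Ring.irreducible_def is_unit_iff_degree
        pcompose_eq_0_iff degree_pcompose)
  fix a b assume ab: "pcompose p [:c, 1:] = a * b"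
  then have "p = pcompose a [:-c, 1:] * pcompose b [:-c, 1:]"
    by (metis inverse_shift pcompose_mult)
  then have "pcompose a [:-c, 1:] dvd 1 \<or> pcompose b [:-c, 1:] dvd 1"
    using assms Factorial_Ring.irreducibleD by blast
  moreover have "pcompose a [:-c, 1:] dvd 1 \<Longrightarrow> a dvd 1" for a
    by (cases "a = 0") (auto simp: is_unit_iff_degree pcompose_eq_0_iff degree_pcompose)
  ultimately show "a dvd 1 \<or> b dvd 1"
    by blast
qed

text \<open>
  A root \<open>r\<close> of the biquadratic polynomial gives \<open>(r\<^sup>2 + m)\<^sup>2 = - c\<close>.  A factorisation into monic
  quadratics has the shape \<open>(X\<^sup>2 + p X + q) (X\<^sup>2 - p X + r)\<close> with \<open>p (r - q) = 0\<close>, because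
  the polynomial has no cubic and no linear term.  If \<open>p = 0\<close>, then \<open>q\<close> and \<open>r\<close> have sum
  \<open>2 m\<close> and product \<open>m\<^sup>2 + c\<close>, so \<open>- c\<close> is the square of half their difference; if
  \<open>q = r\<close>, then \<open>m\<^sup>2 + c = q\<^sup>2\<close>.
\<close>

lemma biquadratic_factor_imp_square:
  fixes m c :: "'a::field_char_0"
  assumes nc: "\<And>t. t^2 \<noteq> - c" and nd: "\<And>t. t^2 \<noteq> m^2 + c"
    and ab: "[:m^2 + c, 0, 2 * m, 0, 1:] = a * b"
    and pos: "Polynomial.degree a > 0" and le: "Polynomial.degree a \<le> 2" 
  shows False
proof (cases "Polynomial.degree a = 1")
  case True
  then obtain a0 a1 where a: "a = [:a0, a1:]" and a1: "a1 \<noteq> 0"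
    by (cases a rule: pCons_cases) (auto split: if_splits elim!: degree_eq_zeroE)
  define r where "r = - a0 / a1"
  have "poly a r = 0"
    using a1 by (simp add: a r_def)
  then have "poly [:m^2 + c, 0, 2 * m, 0, 1:] r = 0"
    unfolding ab by simp
  then have "(r^2 + m)^2 = - c"
    by (simp add: algebra_simps power2_eq_square) Groebner_Basis.algebra
  with nc show False by blast
next
  case False
  with pos le have da: "Polynomial.degree a = 2" by linarith
  have "a \<noteq> 0" "b \<noteq> 0"
    using ab by auto
  then have "Polynomial.degree a + Polynomial.degree b = Polynomial.degree [:m^2 + c, 0, 2 * m, 0, 1:]"
    unfolding ab by (simp add: degree_mult_eq)
  with da have db: "Polynomial.degree b = 2" by simp
  have quadratic: "\<exists>q0 q1 q2. q = [:q0, q1, q2:]" if "Polynomial.degree q = 2" for q :: "'a poly"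
  proof -
    have "q = [:poly.coeff q 0, poly.coeff q 1, poly.coeff q 2:]"
    proof (rule poly_eqI)
      fix n show "poly.coeff q n = poly.coeff [:poly.coeff q 0, poly.coeff q 1, poly.coeff q 2:] n"
        using that coeff_eq_0[of q n]
        by (cases "n \<le> 2") (auto simp: coeff_pCons numeral_2_eq_2 split: nat.splits)
    qed
    then show ?thesis by blast
  qed
  obtain a0 a1 a2 where a: "a = [:a0, a1, a2:]"
    using quadratic[OF da] by blast
  obtain b0 b1 b2 where b: "b = [:b0, b1, b2:]"
    using quadratic[OF db] by blast
  have e: "a2 * b2 = 1" "a2 * b1 + a1 * b2 = 0" "a2 * b0 + a1 * b1 + a0 * b2 = 2 * m"
    "a1 * b0 + a0 * b1 = 0" "a0 * b0 = m^2 + c"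
    using ab unfolding a b by (simp_all add: algebra_simps)
  \<comment> \<open>The lower coefficients of the monic multiples \<open>b2 a\<close> and \<open>a2 b\<close> are \<open>p, q\<close> and \<open>- p, r\<close>.\<close>
  define p q r where "p = a1 * b2" and "q = a0 * b2" and "r = b0 * a2"
  have pq: "p * (r - q) = 0"
    using e unfolding p_def q_def r_def by Groebner_Basis.algebra
  have s: "r - p^2 + q = 2 * m"
    using e unfolding p_def q_def r_def by Groebner_Basis.algebra
  have qr: "q * r = m^2 + c"
    using e unfolding q_def r_def by Groebner_Basis.algebra
  show False
  proof (cases "p = 0")
    case True
    have "q + r = 2 * m" using s True by (simp add: algebra_simps)
    then have "m = (q + r) / 2" by simp
    then have "((q - r) / 2)^2 = - c"
      using qr by (simp add: field_simps power2_eq_square) Groebner_Basis.algebra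
    with nc show False by blast
  next
    case False
    then have "r = q" using pq by simp
    with qr have "q^2 = m^2 + c" by (simp add: power2_eq_square)
    with nd show False by blast
  qed
qed

lemma biquadratic_irreducible:
  fixes m c :: "'a::field_char_0"
  assumes nc: "\<And>t. t^2 \<noteq> - c" and nd: "\<And>t. t^2 \<noteq> m^2 + c"
  shows "Factorial_Ring.irreducible [:m^2 + c, 0, 2 * m, 0, 1:]" (is "Factorial_Ring.irreducible ?q")
proof (rule Factorial_Ring.irreducibleI)
  show "?q \<noteq> 0" by simp
  show "\<not> ?q dvd 1" by (simp add: is_unit_iff_degree)
  fix a b assume ab: "?q = a * b"
  show "a dvd 1 \<or> b dvd 1"
  proof (rule ccontr)
    assume units: "\<not> (a dvd 1 \<or> b dvd 1)"
    have nz: "a \<noteq> 0" "b \<noteq> 0" using ab by auto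
    then have pos: "Polynomial.degree a > 0" "Polynomial.degree b > 0"
      using units by (auto simp: is_unit_iff_degree)
    have "Polynomial.degree a + Polynomial.degree b = Polynomial.degree ?q"
      unfolding ab by (simp add: degree_mult_eq nz)
    then have "Polynomial.degree a \<le> 2 \<or> Polynomial.degree b \<le> 2" by simp linarith
    then show False
      using biquadratic_factor_imp_square[OF nc nd ab pos(1)]
        biquadratic_factor_imp_square[of c m b a, OF nc nd _ pos(2)] ab
      by (auto simp: mult.commute)
  qed
qed

section \<open>The second and third iterates\<close>

lemma pcompose_square_shift:
  fixes q :: "'a::field poly"
  shows "pcompose ([:- g, 1:]^2 + [:d:]) q = (q - [:g:])^2 + [:d:]"
proof -
  have "pcompose [:- g, 1:] q = q - [:g:]"
    by (simp add: pcompose_pCons)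
  then show ?thesis
    by (simp add: pcompose_add pcompose_mult power2_eq_square del: mult_pCons_left mult_pCons_right)
qed

lemma iterate_Suc: "poly_iterate (Suc n) f = pcompose f (poly_iterate n f)"
  by (simp add: poly_iterate_def)

lemma iterate_0: "poly_iterate 0 f = [:0, 1:]"
  by (simp add: poly_iterate_def)

lemma quad_poly_iterate_Suc:
  "poly_iterate (Suc n) (quad_poly k)
     = (poly_iterate n (quad_poly k) - [:coeff_gamma k:])^2 + [:coeff_gamma k + coeff_m k:]"
  unfolding iterate_Suc quad_poly_def by (rule pcompose_square_shift)

text \<open>In the variable \<open>X - \<gamma>\<close> the second iterate is biquadratic.\<close>

lemma quad_poly_iterate2:
  fixes k :: "'a::field_char_0"
  defines "m \<equiv> coeff_m k" and "c \<equiv> coeff_gamma k + coeff_m k"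
  shows "poly_iterate 2 (quad_poly k) = pcompose [:m^2 + c, 0, 2 * m, 0, 1:] [:- coeff_gamma k, 1:]"
proof -
  have "poly (poly_iterate 2 (quad_poly k)) x
      = poly (pcompose [:m^2 + c, 0, 2 * m, 0, 1:] [:- coeff_gamma k, 1:]) x" for x
    by (simp add: numeral_2_eq_2 quad_poly_iterate_Suc iterate_0 poly_pcompose m_def c_def) Groebner_Basis.algebra
  then show ?thesis
    by (simp add: poly_eq_poly_eq_iff[symmetric] fun_eq_iff)
qed

text \<open>
  In the variable \<open>Y = X - \<gamma>\<close> and with \<open>v = k\<^sup>4 - 2 k\<^sup>2\<close> the third iterate is
  \<open>((Y\<^sup>2 + v - 1)\<^sup>2 + v - 1)\<^sup>2 + 4 v\<^sup>3\<close>.  An even polynomial of this kind factors as \<open>h(Y) h(-Y)\<close> once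
  it is a difference \<open>E\<^sup>2 - (Y O)\<^sup>2\<close> with \<open>E\<close> and \<open>O\<close> even.  The constant term
  \<open>v\<^sup>2 (v - 1)\<^sup>2 + 4 v\<^sup>3\<close> equals \<open>(v (v + 1))\<^sup>2\<close>, which fixes the constant term of \<open>h\<close> up to sign, and
  \<open>2 k\<close> as its cubic coefficient makes the remaining coefficients solvable.
\<close>

definition octic_factor :: "'a::field \<Rightarrow> 'a poly" where
  "octic_factor k = [:(k^2 - 1)^2 * (k^4 - 2 * k^2), 2 * k * (k^2 - 2) * (k^2 + 1),
     2 * (k^4 - k^2 - 1), 2 * k, 1:]"

lemma quad_poly_iterate3:
  fixes k :: "'a::field_char_0"
  shows "poly_iterate 3 (quad_poly k)
    = pcompose (octic_factor k) [:- coeff_gamma k, 1:]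
      * pcompose (octic_factor k) [:coeff_gamma k, - 1:]"
proof -
  have "poly (poly_iterate 3 (quad_poly k)) x
    = poly (pcompose (octic_factor k) [:- coeff_gamma k, 1:]
      * pcompose (octic_factor k) [:coeff_gamma k, - 1:]) x" for x
  proof -
    define v where "v = k^4 - 2 * k^2"
    define u where "u = k^2"
    define y where "y = x - coeff_gamma k"
    have m: "coeff_m k = v - 1" by (simp add: coeff_m_def v_def)
    have c: "coeff_gamma k + coeff_m k = 4 * v^3"
      unfolding coeff_gamma_def m v_def by Groebner_Basis.algebra
    have cancel: "a + (coeff_gamma k + b) - coeff_gamma k = a + b" for a b by simp
    have "poly (poly_iterate 3 (quad_poly k)) x
        = ((y^2 + coeff_m k)^2 + coeff_m k)^2 + (coeff_gamma k + coeff_m k)"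
      by (simp only: numeral_3_eq_3 quad_poly_iterate_Suc iterate_0 y_def poly_add poly_diff
          poly_power poly_pCons poly_0 cancel mult_zero_right add_0_right mult_1_right add_0_left)
    also have "\<dots> = ((y^2 + (v - 1))^2 + (v - 1))^2 + 4 * v^3"
      unfolding c unfolding m ..
    \<comment> \<open>Even part squared minus odd part squared of the factor; \<open>k\<close> enters only through \<open>k\<^sup>2 = u\<close>.\<close>
    also have "\<dots> = (y^4 + 2 * (u^2 - u - 1) * y^2 + (u - 1)^2 * (u^2 - 2 * u))^2
        - y^2 * (2 * k)^2 * (y^2 + (u - 2) * (u + 1))^2"
    proof -
      have v: "v = u^2 - 2 * u"
        unfolding v_def u_def by Groebner_Basis.algebra
      have *: "((z + (u^2 - 2 * u - 1))^2 + (u^2 - 2 * u - 1))^2 + 4 * (u^2 - 2 * u)^3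
          = (z^2 + 2 * (u^2 - u - 1) * z + (u - 1)^2 * (u^2 - 2 * u))^2
            - z * (4 * u) * (z + (u - 2) * (u + 1))^2" for z
        by Groebner_Basis.algebra
      have "(2 * k)^2 = 4 * u" "y^4 = (y^2)^2"
        by (simp_all add: u_def)
      then show ?thesis
        unfolding v using *[of "y^2"] by (simp only:)
    qed
    also have "\<dots> = (y^4 + 2 * (u^2 - u - 1) * y^2 + (u - 1)^2 * (u^2 - 2 * u)
          + 2 * k * y * (y^2 + (u - 2) * (u + 1)))
        * (y^4 + 2 * (u^2 - u - 1) * y^2 + (u - 1)^2 * (u^2 - 2 * u)
          - 2 * k * y * (y^2 + (u - 2) * (u + 1)))"
    proof -
      have "p^2 - y^2 * (2 * k)^2 * q^2 = (p + 2 * k * y * q) * (p - 2 * k * y * q)" for p q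
        by Groebner_Basis.algebra
      then show ?thesis .
    qed
    also have "\<dots> = poly (octic_factor k) y * poly (octic_factor k) (- y)"
    proof -
      have eval: "poly (octic_factor k) y = y^4 + 2 * (u^2 - u - 1) * y^2 + (u - 1)^2 * (u^2 - 2 * u)
          + 2 * k * y * (y^2 + (u - 2) * (u + 1))" for y
        unfolding octic_factor_def u_def poly_pCons poly_0 by Groebner_Basis.algebra
      have "(- y)^4 = y^4" "(- y)^2 = y^2" "a + 2 * k * (- y) * b = a - 2 * k * y * b" for a b
        by simp_all
      then show ?thesis
        unfolding eval by (simp only:)
    qed
    finally show ?thesis
      by (simp add: poly_pcompose y_def)
  qed
  then show ?thesis
    by (simp add: poly_eq_poly_eq_iff[symmetric] fun_eq_iff)
qed

lemma quad_poly_iterate3_reducible: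
  fixes k :: "'a::field_char_0"
  shows "\<not> Factorial_Ring.irreducible (poly_iterate 3 (quad_poly k))"
  by (rule reducible_polyI[OF quad_poly_iterate3])
     (simp_all add: degree_pcompose octic_factor_def)

text \<open>
  With \<open>v = k\<^sup>4 - 2 k\<^sup>2\<close> one has \<open>m = v - 1\<close> and \<open>\<gamma> + m = 4 v\<^sup>3\<close>.  The real embedding
  sends \<open>v = k\<^sup>2 (k\<^sup>2 - 2)\<close> to a positive number, so \<open>- 4 v\<^sup>3\<close> is not a square.  Moreover
  \<open>m\<^sup>2 + 4 v\<^sup>3 = (v + 1) (4 v\<^sup>2 - 3 v + 1)\<close> and \<open>v + 1 = (k\<^sup>2 - 1)\<^sup>2\<close>, so the second square
  condition of the biquadratic criterion concerns \<open>4 v\<^sup>2 - 3 v + 1\<close> alone.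
\<close>

lemma quad_poly_iterate2_irreducible:
  fixes k :: "'a::field_char_0" and \<sigma> :: "'a \<Rightarrow> real"
  assumes \<sigma>: "field_embedding \<sigma>" and gt: "\<bar>\<sigma> k\<bar> > sqrt 2"
    and nonsquare: "\<And>t. t^2 \<noteq> 4 * (k^4 - 2 * k^2)^2 - 3 * (k^4 - 2 * k^2) + 1"
  shows "Factorial_Ring.irreducible (poly_iterate 2 (quad_poly k))"
proof -
  have \<sigma>1: "\<sigma> 1 = 1" and add: "\<sigma> (x + y) = \<sigma> x + \<sigma> y" and mult: "\<sigma> (x * y) = \<sigma> x * \<sigma> y" for x y
    using \<sigma> by (auto simp: field_embedding_def)
  have \<sigma>0: "\<sigma> 0 = 0" using add[of 0 0] by simp
  have neg: "\<sigma> (- x) = - \<sigma> x" for x using add[of x "- x"] \<sigma>0 by simp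
  define u where "u = (\<sigma> k)^2"
  have "(sqrt 2)^2 < \<bar>\<sigma> k\<bar>^2"
    using gt by (intro power_strict_mono) auto
  then have u: "u > 2" by (simp add: u_def)
  define v where "v = k^2 * (k^2 - 2)"
  have "\<sigma> 2 = 2"
    using add[of 1 1] \<sigma>1 by simp
  then have "\<sigma> v = u * (u - 2)"
    using add[of "k^2" "-2"] by (simp add: v_def u_def mult neg power2_eq_square)
  with u have v: "\<sigma> v > 0" by simp
  have vk: "k^4 - 2 * k^2 = v" unfolding v_def by Groebner_Basis.algebra
  have m: "coeff_m k = v - 1" by (simp add: coeff_m_def flip: vk)
  have c: "coeff_gamma k + coeff_m k = 4 * v^3"
    unfolding coeff_gamma_def m unfolding v_def by Groebner_Basis.algebra
  have nc: "t^2 \<noteq> - (4 * v^3)" for t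
  proof
    assume "t^2 = - (4 * v^3)"
    then have "(t / v)^2 = - (4 * v)"
      using v \<sigma>0 by (auto simp: field_simps power2_eq_square power3_eq_cube)
    then have "\<sigma> ((t / v) * (t / v)) = \<sigma> (- (v + v + (v + v)))"
      by (simp add: power2_eq_square)
    then have "(\<sigma> (t / v))\<^sup>2 = - (4 * \<sigma> v)"
      by (simp only: mult neg add power2_eq_square)
    with v show False
      by (smt (verit) zero_le_power2)
  qed
  have "k^2 - 1 \<noteq> 0"
  proof
    assume "k^2 - 1 = 0"
    then have "\<sigma> (k * k) = 1" using \<sigma>1 by (simp add: power2_eq_square)
    then show False using u by (simp add: mult u_def power2_eq_square)
  qed
  have nd: "t^2 \<noteq> (v - 1)^2 + 4 * v^3" for t
  proof
    assume "t^2 = (v - 1)^2 + 4 * v^3"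
    also have "\<dots> = (k^2 - 1)^2 * (4 * v^2 - 3 * v + 1)"
      unfolding v_def by Groebner_Basis.algebra
    finally have "(t / (k^2 - 1))^2 = 4 * v^2 - 3 * v + 1"
      using \<open>k^2 - 1 \<noteq> 0\<close> by (simp add: power_divide)
    with nonsquare show False unfolding vk by blast
  qed
  show ?thesis
    unfolding quad_poly_iterate2 unfolding c unfolding m
    using irreducible_pcompose_linear_shift[OF biquadratic_irreducible[OF nc nd]] .
qed

section \<open>Reduction modulo a prime ideal of residue degree one over 3\<close>

lemma ring_of_integers_simps [simp]:
  "x \<in> carrier ring_of_integers \<longleftrightarrow> algebraic_int x"
  "x \<otimes>\<^bsub>ring_of_integers\<^esub> y = x * y"
  "x \<oplus>\<^bsub>ring_of_integers\<^esub> y = x + y"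
  "\<one>\<^bsub>ring_of_integers\<^esub> = 1"
  "\<zero>\<^bsub>ring_of_integers\<^esub> = 0"
  by (simp_all add: ring_of_integers_def)

context
  fixes P :: "'a::field_char_0 set"
  assumes prime: "primeideal P (ring_of_integers :: 'a ring)"
begin

text \<open>
  The ring axioms for \<open>ring_of_integers\<close>, which a prime ideal of it carries along, contain the closure
  of the algebraic integers under sums and products.
\<close>

lemma algebraic_int_add_mult:
  fixes x y :: 'a
  assumes "algebraic_int x" "algebraic_int y"
  shows "algebraic_int (x + y)" "algebraic_int (x * y)"
proof -
  interpret primeideal P "ring_of_integers :: 'a ring" by (rule prime)
  show "algebraic_int (x + y)" "algebraic_int (x * y)"
    using a_closed[of x y] m_closed[of x y] assms by simp_all
qed

lemma algebraic_int_diff: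
  fixes x y :: 'a
  assumes "algebraic_int x" "algebraic_int y"
  shows "algebraic_int (x - y)"
  using algebraic_int_add_mult(1)[of x "- y"] assms by simp

lemma algebraic_int_pow:
  fixes x :: 'a
  assumes "algebraic_int x"
  shows "algebraic_int (x ^ n)"
  using assms by (induction n) (simp_all add: algebraic_int_add_mult)

lemma prime_ideal_subset: "x \<in> P \<Longrightarrow> algebraic_int x"
  using additive_subgroup.a_subset[OF ideal.axioms(1)[OF primeideal.axioms(1)[OF prime]]] by auto

lemma prime_ideal_add: "x \<in> P \<Longrightarrow> y \<in> P \<Longrightarrow> x + y \<in> P"
  using additive_subgroup.a_closed[OF ideal.axioms(1)[OF primeideal.axioms(1)[OF prime]], of x y] by simp

lemma prime_ideal_mult: "x \<in> P \<Longrightarrow> algebraic_int y \<Longrightarrow> x * y \<in> P"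
  using ideal.I_r_closed[OF primeideal.axioms(1)[OF prime], of x y] by simp

lemma prime_ideal_uminus: "x \<in> P \<Longrightarrow> - x \<in> P"
  using prime_ideal_mult[of x "-1"] by simp

lemma prime_ideal_diff: "x \<in> P \<Longrightarrow> y \<in> P \<Longrightarrow> x - y \<in> P"
  using prime_ideal_add[of x "- y"] prime_ideal_uminus by simp

lemma prime_ideal_prime:
  "algebraic_int x \<Longrightarrow> algebraic_int y \<Longrightarrow> x * y \<in> P \<Longrightarrow> x \<in> P \<or> y \<in> P"
  using primeideal.I_prime[OF prime, of x y] by simp

lemma one_notin_prime_ideal: "1 \<notin> P"
proof
  assume "1 \<in> P"
  then have "P = {x. algebraic_int x}"
    using prime_ideal_mult[of 1] prime_ideal_subset by auto
  then show False
    using primeideal.I_notcarr[OF prime] by (auto simp: ring_of_integers_def)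
qed

lemma not_ideal_dvd_principal_iff:
  assumes "algebraic_int k"
  shows "\<not> ideal_dvd P (PIdl\<^bsub>ring_of_integers\<^esub> k) \<longleftrightarrow> k \<notin> P"
proof -
  have "k \<in> PIdl\<^bsub>ring_of_integers\<^esub> k"
    using assms by (auto simp: cgenideal_def intro!: exI[of _ 1])
  moreover have "k \<in> P \<Longrightarrow> PIdl\<^bsub>ring_of_integers\<^esub> k \<subseteq> P"
    using prime_ideal_mult by (auto simp: cgenideal_def mult.commute[of _ k])
  ultimately show ?thesis
    by (auto simp: ideal_dvd_def)
qed

text \<open>
  A one-dimensional residue ring is a single line extension of the zero space; \<open>w\<close> represents the
  vector that spans it.
\<close>

lemma residue_degree_1_imp_int_multiple:
  assumes "has_residue_degree P 1"
  obtains w :: 'a where "algebraic_int w"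
    and "\<And>x. algebraic_int x \<Longrightarrow> \<exists>n::int. x - of_int n * w \<in> P"
proof -
  interpret primeideal P "ring_of_integers :: 'a ring" by (rule prime)
  let ?R = "residue_ring_of P"
  interpret Q: ring ?R by (rule quotient_is_ring)
  have carr: "carrier ?R = {P +>\<^bsub>ring_of_integers\<^esub> x | x. algebraic_int x}"
    by (auto simp: FactRing_def A_RCOSETS_def')
  have "Q.dimension (Suc 0) (residue_prime_field P) (carrier ?R)"
    using assms by (simp add: has_residue_degree_def)
  then obtain v E where v: "v \<in> carrier ?R" and E: "Q.dimension 0 (residue_prime_field P) E"
    and line: "carrier ?R = Q.line_extension (residue_prime_field P) v E"
    by (cases rule: Q.dimension.cases) auto
  from E have E0: "E = {\<zero>\<^bsub>?R\<^esub>}"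
    by (cases rule: Q.dimension.cases) auto
  obtain w where w: "algebraic_int w" "v = P +>\<^bsub>ring_of_integers\<^esub> w"
    using v carr by auto
  show thesis
  proof (rule that[OF w(1)])
    fix x :: 'a assume x: "algebraic_int x"
    then have "P +>\<^bsub>ring_of_integers\<^esub> x \<in> Q.line_extension (residue_prime_field P) v E"
      using carr line by auto
    then obtain n :: int where "P +>\<^bsub>ring_of_integers\<^esub> x
        = (P +>\<^bsub>ring_of_integers\<^esub> of_int n) \<otimes>\<^bsub>?R\<^esub> v \<oplus>\<^bsub>?R\<^esub> \<zero>\<^bsub>?R\<^esub>"
      unfolding Q.line_extension_mem_iff E0 by (auto simp: residue_prime_field_def)
    moreover have "P +>\<^bsub>ring_of_integers\<^esub> of_int n \<in> carrier ?R"
      unfolding carr by auto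
    ultimately have "P +>\<^bsub>ring_of_integers\<^esub> x = (P +>\<^bsub>ring_of_integers\<^esub> of_int n) \<otimes>\<^bsub>?R\<^esub> v"
      using v by simp
    also have "\<dots> = P +>\<^bsub>ring_of_integers\<^esub> (of_int n * w)"
      using rcoset_mult_add[of "of_int n" w] w by (simp add: FactRing_def)
    finally have "P +>\<^bsub>ring_of_integers\<^esub> x = P +>\<^bsub>ring_of_integers\<^esub> (of_int n * w)" .
    moreover have "x \<in> P +>\<^bsub>ring_of_integers\<^esub> x"
      using additive_subgroup.zero_closed[OF is_additive_subgroup] by (force simp: a_r_coset_def')
    ultimately obtain p where "p \<in> P" "x = p + of_int n * w"
      by (auto simp: a_r_coset_def')
    then show "\<exists>n::int. x - of_int n * w \<in> P"
      by (intro exI[of _ n]) simp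
  qed
qed

text \<open>
  The spanning vector \<open>w\<close> is itself congruent to an integer: \<open>w\<^sup>2 \<equiv> b w\<close> for some integer
  \<open>b\<close>, and \<open>w\<close> is not in \<open>P\<close> since \<open>1\<close> is one of its multiples modulo \<open>P\<close>, so
  \<open>w \<equiv> b\<close> by primality.
\<close>

lemma residue_degree_1_imp_congruent_int:
  assumes "has_residue_degree P 1" and x: "algebraic_int x"
  obtains n :: int where "x - of_int n \<in> P"
proof -
  obtain w where w: "algebraic_int w"
    and mult: "\<And>x. algebraic_int x \<Longrightarrow> \<exists>n::int. x - of_int n * w \<in> P"
    using residue_degree_1_imp_int_multiple[OF assms(1)] by metis
  have "w \<notin> P"
  proof
    assume "w \<in> P"
    obtain n :: int where "1 - of_int n * w \<in> P"
      using mult[of 1] by auto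
    with \<open>w \<in> P\<close> have "1 - of_int n * w + w * of_int n \<in> P"
      by (intro prime_ideal_add prime_ideal_mult) simp_all
    then show False
      using one_notin_prime_ideal by (simp add: mult.commute)
  qed
  obtain b :: int where "w * w - of_int b * w \<in> P"
    using mult[of "w * w"] w by (auto simp: algebraic_int_add_mult)
  then have "w * (w - of_int b) \<in> P"
    by (simp add: algebra_simps)
  then have wb: "w - of_int b \<in> P"
    using prime_ideal_prime[of w "w - of_int b"] w \<open>w \<notin> P\<close> by (auto simp: algebraic_int_diff)
  obtain a :: int where "x - of_int a * w \<in> P"
    using mult[OF x] by blast
  then have "(x - of_int a * w) + (w - of_int b) * of_int a \<in> P"
    using wb by (intro prime_ideal_add prime_ideal_mult) simp_all
  then have "x - of_int (a * b) \<in> P"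
    by (simp add: algebra_simps)
  then show thesis by (rule that)
qed

lemma prime_ideal_cong_mult:
  assumes "x - x' \<in> P" "y - y' \<in> P" "algebraic_int x'" "algebraic_int y"
  shows "x * y - x' * y' \<in> P"
proof -
  have "(x - x') * y + (y - y') * x' \<in> P"
    using assms by (intro prime_ideal_add prime_ideal_mult)
  then show ?thesis by (simp add: algebra_simps)
qed

text \<open>
  A square root \<open>t\<close> of an algebraic integer is an algebraic integer, so \<open>t\<close> and \<open>k\<close> are congruent to
  integers \<open>j\<close> and \<open>n\<close> modulo \<open>P\<close>, and the equation becomes a congruence of integers modulo 3.
  There \<open>n\<close> is not divisible by 3, so \<open>n\<^sup>2 \<equiv> 1\<close>, \<open>v \<equiv> -1\<close> and
  \<open>4 v\<^sup>2 - 3 v + 1 \<equiv> 2\<close>, which is not a square modulo 3.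
\<close>

lemma quadratic_nonsquare:
  fixes k t :: 'a
  assumes over: "lies_over P 3" and deg: "has_residue_degree P 1"
    and k: "algebraic_int k" "k \<notin> P"
  shows "t^2 \<noteq> 4 * (k^4 - 2 * k^2)^2 - 3 * (k^4 - 2 * k^2) + 1"
proof
  define v where "v = k^4 - 2 * k^2"
  assume "t^2 = 4 * (k^4 - 2 * k^2)^2 - 3 * (k^4 - 2 * k^2) + 1"
  then have t: "t^2 = 4 * v^2 - 3 * v + 1" by (simp add: v_def)
  have int_in_P: "of_int n \<in> P \<longleftrightarrow> 3 dvd n" for n
    using over by (auto simp: lies_over_def)
  have v: "algebraic_int v"
    unfolding v_def by (intro algebraic_int_diff algebraic_int_add_mult algebraic_int_pow k) simp
  have "algebraic_int (t^2)"
    unfolding t by (intro algebraic_int_diff algebraic_int_add_mult algebraic_int_pow v) simp_all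
  then have "algebraic_int t"
    by (rule algebraic_int_root[where p = "Polynomial.monom 1 2"])
       (auto simp: poly_monom Polynomial.degree_monom_eq)
  then obtain j :: int where j: "t - of_int j \<in> P"
    using residue_degree_1_imp_congruent_int[OF deg] by blast
  obtain n :: int where n: "k - of_int n \<in> P"
    using residue_degree_1_imp_congruent_int[OF deg k(1)] by blast
  define w where "w = n^4 - 2 * n^2"
  have tj: "t^2 - of_int (j^2) \<in> P"
    using prime_ideal_cong_mult[OF j j] \<open>algebraic_int t\<close> by (simp add: power2_eq_square)
  have kn2: "k^2 - of_int (n^2) \<in> P"
    using prime_ideal_cong_mult[OF n n] k by (simp add: power2_eq_square)
  have "k^2 * (k^2 - 2) - of_int (n^2) * (of_int (n^2) - 2) \<in> P"
    using kn2 k by (intro prime_ideal_cong_mult)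
      (simp_all add: algebraic_int_diff algebraic_int_pow flip: of_int_power)
  then have vw: "v - of_int w \<in> P"
    by (simp add: v_def w_def algebra_simps flip: power_add)
  have "v * (4 * v - 3) - of_int w * of_int (4 * w - 3) \<in> P"
  proof (rule prime_ideal_cong_mult[OF vw])
    have "(v - of_int w) * 4 \<in> P"
      using vw by (intro prime_ideal_mult) simp_all
    then show "4 * v - 3 - of_int (4 * w - 3) \<in> P"
      by (simp add: algebra_simps)
  qed (use v in \<open>auto intro!: algebraic_int_diff algebraic_int_add_mult\<close>)
  from prime_ideal_diff[OF this tj] have "of_int (j^2 - (w * (4 * w - 3) + 1)) \<in> P"
    unfolding t by (simp add: algebra_simps power2_eq_square)
  then have dvd: "3 dvd j^2 - (w * (4 * w - 3) + 1)"
    by (simp only: int_in_P)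
  have "\<not> 3 dvd n"
  proof
    assume "3 dvd n"
    then have "k - of_int n + of_int n \<in> P"
      using n int_in_P by (intro prime_ideal_add) auto
    with k show False by simp
  qed
  then have "n mod 3 = 1 \<or> n mod 3 = 2" by presburger
  moreover have "w mod 3 = ((n mod 3)^4 - 2 * (n mod 3)^2) mod 3"
    unfolding w_def
    by (intro mod_diff_cong) (simp add: power_mod, metis mod_mult_right_eq power_mod)
  ultimately have w: "w mod 3 = 2" by auto
  define q where "q = w div 3"
  have "w = 3 * q + 2"
    using w unfolding q_def by presburger
  then have "w * (4 * w - 3) + 1 = 2 + 3 * (12 * q^2 + 13 * q + 3)"
    by (simp add: algebra_simps power2_eq_square)
  then have "(w * (4 * w - 3) + 1) mod 3 = 2" by (simp only: mod_mult_self2) simp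
  then have "j^2 mod 3 = 2" using dvd by presburger
  moreover have "j mod 3 = 0 \<or> j mod 3 = 1 \<or> j mod 3 = 2" by presburger
  moreover have "j^2 mod 3 = (j mod 3)^2 mod 3" by (simp add: mod_simps)
  ultimately show False by auto
qed

end

section \<open>Embeddings of number fields\<close>

text \<open>
  In a space of dimension at most \<open>n\<close> the \<open>n + 1\<close> powers \<open>x\<^sup>0, \<dots>, x\<^sup>n\<close> either repeat or are linearly
  dependent; either way \<open>x\<close> is a root of a nonzero rational polynomial.
\<close>

lemma number_field_algebraic:
  fixes x :: "'a::field_char_0"
  assumes "number_field TYPE('a)"
  shows "algebraic x"
proof -
  interpret vector_space "\<lambda>(q::rat) (x::'a). of_rat q * x"
    by standard (simp_all add: algebra_simps of_rat_add of_rat_mult)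
  obtain B :: "'a set" where B: "finite B" "span B = UNIV"
    using assms by (auto simp: number_field_def)
  define n where "n = card B"
  define S where "S = (\<lambda>i. x ^ i) ` {..n}"
  show ?thesis
  proof (cases "inj_on (\<lambda>i. x ^ i) {..n}")
    case False
    then obtain i j where ij: "i \<noteq> j" "x ^ i = x ^ j"
      by (auto simp: inj_on_def)
    then have "poly.coeff (Polynomial.monom 1 i - Polynomial.monom (1::'a) j) i \<noteq> 0"
      by simp
    then have "Polynomial.monom 1 i - Polynomial.monom (1::'a) j \<noteq> 0"
      by (metis coeff_0)
    with ij show ?thesis
      by (intro algebraicI[of "Polynomial.monom 1 i - Polynomial.monom 1 j"])
         (auto simp: poly_monom)
  next
    case True
    then have "card S = Suc (card B)"
      by (simp add: S_def card_image n_def)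
    then have "dependent S"
      using independent_span_bound[OF B(1), of S] B(2) by auto
    then obtain u s where u: "s \<in> S" "u s \<noteq> 0" "(\<Sum>s\<in>S. of_rat (u s) * s) = 0"
      using dependent_finite[of S] by (auto simp: S_def)
    obtain i where i: "i \<le> n" "s = x ^ i" using u by (auto simp: S_def)
    define p where "p = (\<Sum>i\<le>n. Polynomial.monom (of_rat (u (x ^ i)) :: 'a) i)"
    have coeff: "poly.coeff p i = (if i \<le> n then of_rat (u (x ^ i)) else 0)" for i
      by (simp add: p_def coeff_sum)
    show ?thesis
    proof (rule algebraicI')
      show "poly.coeff p i \<in> \<rat>" for i by (simp add: coeff)
      show "p \<noteq> 0" using coeff[of i] i u by auto
      show "poly p x = 0"
        using u(3) by (simp add: S_def sum.reindex[OF True] p_def poly_sum poly_monom)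
    qed
  qed
qed

text \<open>
  The domain is only required to be a ring containing the rationals.  When every element is algebraic
  over the rationals, such a ring is a field, so adjoining an element never requires a separate
  treatment of quotients.
\<close>

definition partial_embedding :: "'a::field_char_0 set \<Rightarrow> ('a \<Rightarrow> complex) \<Rightarrow> bool" where
  "partial_embedding F \<sigma> \<longleftrightarrow> \<rat> \<subseteq> F \<and> \<sigma> 1 = 1 \<and>
     (\<forall>x\<in>F. \<forall>y\<in>F. x + y \<in> F \<and> x * y \<in> F \<and> \<sigma> (x + y) = \<sigma> x + \<sigma> y \<and> \<sigma> (x * y) = \<sigma> x * \<sigma> y)"

abbreviation polys_over :: "'a::zero set \<Rightarrow> 'a poly set" where
  "polys_over F \<equiv> {p. \<forall>i. poly.coeff p i \<in> F}"

text \<open>Powers of the indeterminate are cancelled from an annihilating polynomial of a nonzero number.\<close>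

lemma algebraic_imp_nonzero_const_coeff:
  fixes x :: "'a::field_char_0"
  assumes "p \<noteq> 0" "\<And>i. poly.coeff p i \<in> \<rat>" "poly p x = 0" "x \<noteq> 0"
  shows "\<exists>q. (\<forall>i. poly.coeff q i \<in> \<rat>) \<and> poly q x = 0 \<and> poly.coeff q 0 \<noteq> 0"
  using assms
proof (induction p)
  case (pCons a p)
  show ?case
  proof (cases "a = 0")
    case True
    have "poly.coeff p i \<in> \<rat>" for i
      using pCons.prems(2)[of "Suc i"] by simp
    then show ?thesis
      using pCons True by auto
  next
    case False
    then show ?thesis
      using pCons.prems by (intro exI[of _ "pCons a p"]) auto
  qed
qed auto

lemma rational_poly_value_in_ring:
  fixes x :: "'a::field_char_0"
  assumes "\<rat> \<subseteq> F" "\<And>x y. x \<in> F \<Longrightarrow> y \<in> F \<Longrightarrow> x + y \<in> F \<and> x * y \<in> F" "x \<in> F"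
    and "\<And>i. poly.coeff p i \<in> F"
  shows "poly p x \<in> F"
  using assms(4)
proof (induction p)
  case 0
  then show ?case using assms(1) by auto
next
  case (pCons a p)
  have "poly p x \<in> F" using pCons.IH pCons.prems by (metis coeff_pCons_Suc)
  moreover have "a \<in> F" using pCons.prems[of 0] by simp
  ultimately show ?case using assms by simp
qed

text \<open>
  If \<open>a + x p(x) = 0\<close> with \<open>a\<close> a nonzero rational, then \<open>- p(x) / a\<close> is the inverse of \<open>x\<close>.
\<close>

lemma algebraic_inverse_in_ring:
  fixes x :: "'a::field_char_0"
  assumes F: "\<rat> \<subseteq> F" "\<And>x y. x \<in> F \<Longrightarrow> y \<in> F \<Longrightarrow> x + y \<in> F \<and> x * y \<in> F"
    and x: "x \<in> F" "algebraic x"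
  shows "inverse x \<in> F"
proof (cases "x = 0")
  case True
  then show ?thesis using F by auto
next
  case False
  then obtain q where q: "\<And>i. poly.coeff q i \<in> \<rat>" "poly q x = 0" "poly.coeff q 0 \<noteq> 0"
    using x(2) algebraic_imp_nonzero_const_coeff[of _ x] unfolding algebraic_altdef by metis
  obtain a p where ap: "q = pCons a p" by (cases q)
  have a: "a \<noteq> 0" "a \<in> \<rat>" using q(3) q(1)[of 0] by (auto simp: ap)
  have "poly.coeff p i \<in> F" for i
    using q(1)[of "Suc i"] F(1) by (auto simp: ap)
  then have "poly p x \<in> F"
    using rational_poly_value_in_ring[OF F x(1)] by blast
  moreover have "- inverse a \<in> F"
    using a F(1) by auto
  ultimately have "poly p x * - inverse a \<in> F"
    using F(2) by blast
  also have "x * poly p x = - a"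
    using q(2) by (simp add: ap add_eq_0_iff)
  then have "poly p x * - inverse a = inverse x"
    using False a by (simp add: field_simps)
  finally show ?thesis .
qed

context
  fixes F :: "'a::field_char_0 set" and \<sigma> :: "'a \<Rightarrow> complex"
  assumes emb: "partial_embedding F \<sigma>" and alg: "\<And>x :: 'a. algebraic x"
begin

lemma partial_embedding_closed:
  shows "\<rat> \<subseteq> F" "0 \<in> F" "1 \<in> F"
    and "x \<in> F \<Longrightarrow> y \<in> F \<Longrightarrow> x + y \<in> F" "x \<in> F \<Longrightarrow> y \<in> F \<Longrightarrow> x * y \<in> F"
    and "x \<in> F \<Longrightarrow> inverse x \<in> F" and "x \<in> F \<Longrightarrow> - x \<in> F"
proof -
  show Q: "\<rat> \<subseteq> F" and c: "\<And>x y. x \<in> F \<Longrightarrow> y \<in> F \<Longrightarrow> x + y \<in> F" "\<And>x y. x \<in> F \<Longrightarrow> y \<in> F \<Longrightarrow> x * y \<in> F"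
    using emb by (auto simp: partial_embedding_def)
  show "x \<in> F \<Longrightarrow> inverse x \<in> F"
    using algebraic_inverse_in_ring[OF Q _ _ alg, of x] c by simp
  show "0 \<in> F" "1 \<in> F" using Q by auto
  have "-1 \<in> F" using Q by auto
  then show "x \<in> F \<Longrightarrow> - x \<in> F" using c(2)[of "-1" x] by simp
qed

lemma partial_embedding_hom:
  shows "\<sigma> 1 = 1" "\<sigma> 0 = 0"
    and "x \<in> F \<Longrightarrow> y \<in> F \<Longrightarrow> \<sigma> (x + y) = \<sigma> x + \<sigma> y"
    and "x \<in> F \<Longrightarrow> y \<in> F \<Longrightarrow> \<sigma> (x * y) = \<sigma> x * \<sigma> y"
    and "x \<in> F \<Longrightarrow> \<sigma> x = 0 \<longleftrightarrow> x = 0"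
proof -
  show 1: "\<sigma> 1 = 1" and a: "\<And>x y. x \<in> F \<Longrightarrow> y \<in> F \<Longrightarrow> \<sigma> (x + y) = \<sigma> x + \<sigma> y"
    and m: "\<And>x y. x \<in> F \<Longrightarrow> y \<in> F \<Longrightarrow> \<sigma> (x * y) = \<sigma> x * \<sigma> y"
    using emb by (auto simp: partial_embedding_def)
  show 0: "\<sigma> 0 = 0" using a[of 0 0] partial_embedding_closed by simp
  show "\<sigma> x = 0 \<longleftrightarrow> x = 0" if "x \<in> F"
  proof
    assume "\<sigma> x = 0"
    then have "\<sigma> (x * inverse x) = 0"
      using m[of x "inverse x"] that partial_embedding_closed by simp
    then show "x = 0" using 1 by (cases "x = 0") auto
  qed (simp add: 0)
qed

lemma sum_in_F: "(\<And>i. i \<in> A \<Longrightarrow> f i \<in> F) \<Longrightarrow> sum f A \<in> F"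
  by (induction A rule: infinite_finite_induct) (auto intro: partial_embedding_closed)

lemma hom_sum: "(\<And>i. i \<in> A \<Longrightarrow> f i \<in> F) \<Longrightarrow> \<sigma> (sum f A) = (\<Sum>i\<in>A. \<sigma> (f i))"
  by (induction A rule: infinite_finite_induct)
     (auto simp: partial_embedding_hom sum_in_F)

lemma polys_over_closed:
  assumes "p \<in> polys_over F" "q \<in> polys_over F"
  shows "p + q \<in> polys_over F" "p * q \<in> polys_over F"
  using assms by (auto simp: coeff_mult intro!: partial_embedding_closed sum_in_F)

lemma map_poly_hom:
  assumes "p \<in> polys_over F" "q \<in> polys_over F"
  shows "map_poly \<sigma> (p + q) = map_poly \<sigma> p + map_poly \<sigma> q"
    and "map_poly \<sigma> (p * q) = map_poly \<sigma> p * map_poly \<sigma> q"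
  using assms
  by (auto intro!: poly_eqI sum.cong
      simp: coeff_map_poly partial_embedding_hom coeff_mult hom_sum partial_embedding_closed)

text \<open>
  For \<open>z\<close> take a complex root of the image of a polynomial \<open>\<mu>\<close> of least degree over \<open>F\<close> that
  annihilates \<open>b\<close>.  Every annihilating polynomial over \<open>F\<close> is a multiple of \<open>\<mu>\<close> over
  \<open>F\<close>, hence its image vanishes at \<open>z\<close>; the induction on the degree carries out this division one
  leading term at a time, which keeps the coefficients visibly in \<open>F\<close>.
\<close>

lemma extension_well_defined:
  fixes b :: 'a
  obtains z where "\<And>p. p \<in> polys_over F \<Longrightarrow> poly p b = 0 \<Longrightarrow> poly (map_poly \<sigma> p) z = 0"
proof -
  let ?ann = "\<lambda>p. p \<in> polys_over F \<and> p \<noteq> 0 \<and> poly p b = 0"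
  obtain p0 where "?ann p0"
    using alg[of b] partial_embedding_closed(1) unfolding algebraic_altdef by blast
  define \<mu> where "\<mu> = (ARG_MIN Polynomial.degree p. ?ann p)"
  have \<mu>: "?ann \<mu>" and min: "\<And>p. ?ann p \<Longrightarrow> Polynomial.degree \<mu> \<le> Polynomial.degree p"
    using arg_min_nat_lemma[of ?ann p0 Polynomial.degree] \<open>?ann p0\<close> unfolding \<mu>_def by blast+
  have deg: "Polynomial.degree \<mu> > 0"
    using \<mu> by (auto elim!: degree_eq_zeroE intro!: Nat.gr0I)
  have "Polynomial.degree (map_poly \<sigma> \<mu>) = Polynomial.degree \<mu>"
    using \<mu> by (intro map_poly_degree_eq) (simp add: partial_embedding_hom)
  with deg have "\<not> constant (poly (map_poly \<sigma> \<mu>))"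
    using constant_degree by (metis less_numeral_extra(3))
  then obtain z where z: "poly (map_poly \<sigma> \<mu>) z = 0"
    using fundamental_theorem_of_algebra by blast
  have "poly (map_poly \<sigma> p) z = 0" if "p \<in> polys_over F" "poly p b = 0" for p
    using that
  proof (induction "Polynomial.degree p" arbitrary: p rule: less_induct)
    case less
    show ?case
    proof (cases "p = 0")
      case False
      then have le: "Polynomial.degree \<mu> \<le> Polynomial.degree p"
        using min less.prems by blast
      define c where "c = lead_coeff p * inverse (lead_coeff \<mu>)"
      define s where "s = Polynomial.monom c (Polynomial.degree p - Polynomial.degree \<mu>)"
      define r where "r = p + s * (- \<mu>)"
      have "c \<in> F"
        using less.prems \<mu> by (auto simp: c_def intro!: partial_embedding_closed)
      then have s: "s \<in> polys_over F"
        by (auto simp: s_def partial_embedding_closed)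
      have mm: "s * (- \<mu>) \<in> polys_over F"
        using s \<mu> by (intro polys_over_closed(2)) (auto intro: partial_embedding_closed)
      then have r: "r \<in> polys_over F"
        unfolding r_def using less.prems by (intro polys_over_closed(1))
      have "poly r b = 0"
        using less.prems \<mu> by (simp add: r_def)
      have lead: "poly.coeff r (Polynomial.degree p) = 0"
        using \<mu> le by (simp add: r_def s_def c_def coeff_monom_mult)
      have "Polynomial.degree s \<le> Polynomial.degree p - Polynomial.degree \<mu>"
        unfolding s_def by (rule degree_monom_le)
      then have "Polynomial.degree (s * (- \<mu>)) \<le> Polynomial.degree p"
        using le degree_mult_le[of s "- \<mu>"] by simp
      then have "Polynomial.degree r \<le> Polynomial.degree p"
        unfolding r_def by (intro degree_add_le) auto
      moreover have "Polynomial.degree r \<noteq> Polynomial.degree p"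
      proof
        assume "Polynomial.degree r = Polynomial.degree p"
        with lead have "r = 0" by (metis leading_coeff_0_iff)
        with \<open>Polynomial.degree r = Polynomial.degree p\<close> deg le show False by simp
      qed
      ultimately have "Polynomial.degree r < Polynomial.degree p"
        by simp
      then have "poly (map_poly \<sigma> r) z = 0"
        using less.hyps r \<open>poly r b = 0\<close> by blast
      moreover have "p = r + s * \<mu>"
        by (simp add: r_def)
      then have "map_poly \<sigma> p = map_poly \<sigma> r + map_poly \<sigma> s * map_poly \<sigma> \<mu>"
        using r s \<mu> polys_over_closed by (simp add: map_poly_hom del: mem_Collect_eq)
      ultimately show ?thesis using z by simp
    qed simp
  qed
  then show thesis by (rule that)
qed

text \<open>
  The extension to \<open>F[b]\<close> sends \<open>p(b)\<close> to the value at \<open>z\<close> of the image of \<open>p\<close>; by the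
  choice of \<open>z\<close> this does not depend on the polynomial \<open>p\<close> that represents the element.
\<close>

lemma partial_embedding_extend:
  obtains F' \<sigma>' where "partial_embedding F' \<sigma>'" "F \<subseteq> F'" "b \<in> F'"
proof -
  obtain z where z: "\<And>p. p \<in> polys_over F \<Longrightarrow> poly p b = 0 \<Longrightarrow> poly (map_poly \<sigma> p) z = 0"
    using extension_well_defined[of b] by blast
  define F' where "F' = (\<lambda>p. poly p b) ` polys_over F"
  define \<sigma>' where "\<sigma>' x = poly (map_poly \<sigma> (SOME p. p \<in> polys_over F \<and> poly p b = x)) z" for x
  have \<sigma>': "\<sigma>' (poly p b) = poly (map_poly \<sigma> p) z" if p: "p \<in> polys_over F" for p
  proof -
    define q where "q = (SOME q. q \<in> polys_over F \<and> poly q b = poly p b)"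
    have q: "q \<in> polys_over F" "poly q b = poly p b"
      unfolding q_def using someI[of "\<lambda>q. q \<in> polys_over F \<and> poly q b = poly p b" p] p by blast+
    have nF: "[:-1:] * p \<in> polys_over F"
      using p by (intro polys_over_closed(2)) (auto simp: coeff_pCons partial_embedding_closed split: nat.splits)
    then have "q + [:-1:] * p \<in> polys_over F"
      using q by (intro polys_over_closed(1))
    then have "poly (map_poly \<sigma> (q + [:-1:] * p)) z = 0"
      using z q by simp
    moreover have "p + [:-1:] * p = 0" by simp
    then have "map_poly \<sigma> p + map_poly \<sigma> ([:-1:] * p) = 0"
      using map_poly_hom(1)[OF p nF] by simp
    then have "poly (map_poly \<sigma> p) z + poly (map_poly \<sigma> ([:-1:] * p)) z = 0"
      by (metis poly_add poly_0)
    ultimately have "poly (map_poly \<sigma> q) z + poly (map_poly \<sigma> ([:-1:] * p)) z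
        = poly (map_poly \<sigma> p) z + poly (map_poly \<sigma> ([:-1:] * p)) z"
      using map_poly_hom(1)[OF q(1) nF] by (metis poly_add)
    then have "poly (map_poly \<sigma> q) z = poly (map_poly \<sigma> p) z"
      by (rule add_right_imp_eq)
    then show ?thesis by (simp add: \<sigma>'_def q_def)
  qed
  have const: "[:a:] \<in> polys_over F" if "a \<in> F" for a
    using that by (auto simp: coeff_pCons partial_embedding_closed split: nat.splits)
  have sub: "F \<subseteq> F'"
    using const by (force simp: F'_def simp del: mem_Collect_eq)
  show thesis
  proof (rule that[of F' \<sigma>'])
    show "F \<subseteq> F'" by (rule sub)
    have "[:0, 1:] \<in> polys_over F"
      by (auto simp: coeff_pCons partial_embedding_closed split: nat.splits)
    then show "b \<in> F'" by (force simp: F'_def simp del: mem_Collect_eq)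
    show "partial_embedding F' \<sigma>'"
      unfolding partial_embedding_def
    proof (intro conjI ballI)
      show "\<rat> \<subseteq> F'" using sub partial_embedding_closed by blast
      show "\<sigma>' 1 = 1"
        using \<sigma>'[OF const[of 1]] partial_embedding_closed
        by (simp add: map_poly_pCons partial_embedding_hom)
      fix x y assume "x \<in> F'" "y \<in> F'"
      then obtain p q where p: "p \<in> polys_over F" "x = poly p b"
        and q: "q \<in> polys_over F" "y = poly q b"
        by (auto simp: F'_def)
      have xy: "x + y = poly (p + q) b" "x * y = poly (p * q) b"
        using p q by simp_all
      note closed = polys_over_closed[OF p(1) q(1)]
      show "x + y \<in> F'" "x * y \<in> F'"
        unfolding xy F'_def using closed by blast+
      have "\<sigma>' (x + y) = poly (map_poly \<sigma> (p + q)) z"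
        by (simp only: xy(1) \<sigma>'[OF closed(1)])
      then show "\<sigma>' (x + y) = \<sigma>' x + \<sigma>' y"
        by (simp only: map_poly_hom(1)[OF p(1) q(1)] poly_add p(2) q(2) \<sigma>'[OF p(1)] \<sigma>'[OF q(1)])
      have "\<sigma>' (x * y) = poly (map_poly \<sigma> (p * q)) z"
        by (simp only: xy(2) \<sigma>'[OF closed(2)])
      then show "\<sigma>' (x * y) = \<sigma>' x * \<sigma>' y"
        by (simp only: map_poly_hom(2)[OF p(1) q(1)] poly_mult p(2) q(2) \<sigma>'[OF p(1)] \<sigma>'[OF q(1)])
    qed
  qed
qed

end

lemma partial_embedding_Rats: "\<exists>\<sigma>. partial_embedding (\<rat> :: 'a::field_char_0 set) \<sigma>"
proof -
  define \<sigma> :: "'a \<Rightarrow> complex"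
    where "\<sigma> x = of_rat (inv_into UNIV (of_rat :: rat \<Rightarrow> 'a) x)" for x
  have \<sigma>: "\<sigma> (of_rat q) = (of_rat q :: complex)" for q
    by (simp add: \<sigma>_def inv_f_f inj_def)
  have "\<sigma> 1 = 1" using \<sigma>[of 1] by simp
  moreover have "\<sigma> (x + y) = \<sigma> x + \<sigma> y" "\<sigma> (x * y) = \<sigma> x * \<sigma> y" if "x \<in> \<rat>" "y \<in> \<rat>" for x y
    using that by (auto simp: Rats_def \<sigma> simp flip: of_rat_add of_rat_mult)
  ultimately show ?thesis
    by (auto simp: partial_embedding_def)
qed

text \<open>
  Starting from the rationals, the elements of a finite spanning set are adjoined one by one.  A ring
  that contains the rationals is a rational subspace, so the last domain is the whole field.
\<close>

lemma number_field_complex_embedding: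
  assumes "number_field TYPE('a::field_char_0)"
  obtains \<sigma> :: "'a::field_char_0 \<Rightarrow> complex" where "field_embedding \<sigma>"
proof -
  interpret vector_space "\<lambda>(q::rat) (x::'a). of_rat q * x"
    by standard (simp_all add: algebra_simps of_rat_add of_rat_mult)
  obtain B :: "'a set" where B: "finite B" "span B = UNIV"
    using assms by (auto simp: number_field_def)
  have "\<exists>F \<sigma>. partial_embedding F \<sigma> \<and> B \<subseteq> F"
    using B(1)
  proof induction
    case empty
    then show ?case using partial_embedding_Rats by blast
  next
    case (insert b B)
    then obtain F \<sigma> where F: "partial_embedding F \<sigma>" "B \<subseteq> F" by blast
    obtain F' \<sigma>' where "partial_embedding F' \<sigma>'" "F \<subseteq> F'" "b \<in> F'"
      using partial_embedding_extend[OF F(1) number_field_algebraic[OF assms], of b] by blast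
    with F show ?case by blast
  qed
  then obtain F \<sigma> where F: "partial_embedding F \<sigma>" "B \<subseteq> F" by blast
  have "subspace F"
    using F(1) unfolding subspace_def partial_embedding_def
    by (metis Rats_0 Rats_of_rat subsetD)
  then have "F = UNIV"
    using B(2) span_minimal[OF F(2)] by auto
  then have "field_embedding \<sigma>"
    using F(1) by (simp add: field_embedding_def partial_embedding_def)
  then show thesis by (rule that)
qed

lemma totally_real_number_field_real_embedding:
  assumes "number_field TYPE('a::field_char_0)" "totally_real TYPE('a::field_char_0)"
  obtains \<sigma> :: "'a::field_char_0 \<Rightarrow> real" where "field_embedding \<sigma>"
proof -
  obtain \<tau> :: "'a \<Rightarrow> complex" where \<tau>: "field_embedding \<tau>"
    using number_field_complex_embedding[OF assms(1)] .
  then have "\<tau> x \<in> \<real>" for x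
    using assms(2) by (auto simp: totally_real_def)
  then have "\<tau> x = of_real (Re (\<tau> x))" for x
    by simp
  with \<tau> have "field_embedding (\<lambda>x. Re (\<tau> x))"
    unfolding field_embedding_def 
    by (metis Re_complex_of_real of_real_mult one_complex.sel(1) plus_complex.sel(1))
  then show thesis by (rule that)
qed

section \<open>Newly reducible third iterates\<close>

lemma field_embedding_of_nat:
  fixes \<sigma> :: "'a::field_char_0 \<Rightarrow> real"
  assumes "field_embedding \<sigma>"
  shows "\<sigma> (of_nat n) = of_nat n"
proof (induction n)
  case 0
  have "\<sigma> (0 + 0) = \<sigma> 0 + \<sigma> 0"
    using assms unfolding field_embedding_def by blast
  then show ?case by simp
next
  case (Suc n)
  then show ?case
    using assms by (simp add: field_embedding_def)
qed

lemma quad_poly_newly_reducible: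
  fixes k :: "'a::field_char_0" and \<sigma> :: "'a \<Rightarrow> real"
  assumes "primeideal P (ring_of_integers :: 'a ring)" "lies_over P 3" "has_residue_degree P 1"
    and "field_embedding \<sigma>" "\<bar>\<sigma> k\<bar> > sqrt 2" "algebraic_int k" "k \<notin> P"
  shows "newly_reducible_iterate 3 (quad_poly k)"
  unfolding newly_reducible_iterate_def
  using quad_poly_iterate2_irreducible[OF assms(4,5) quadratic_nonsquare[OF assms(1-3,6,7)]]
    quad_poly_iterate3_reducible[of k]
  by simp

lemma quad_poly_coeffs:
  "quad_poly k = [:(coeff_gamma k)^2 + coeff_gamma k + coeff_m k, - 2 * coeff_gamma k, 1:]"
  by (simp add: quad_poly_def power2_eq_square)

text \<open>
  The polynomial determines \<open>\<gamma>\<close> and hence \<open>m\<close>.  The difference of the values of \<open>m\<close> at \<open>a\<close>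
  and \<open>b\<close> is \<open>(a\<^sup>2 - b\<^sup>2) (a\<^sup>2 + b\<^sup>2 - 2)\<close>, whose second factor is positive for natural numbers
  \<open>a, b \<ge> 2\<close>.
\<close>

lemma quad_poly_of_nat_inj:
  assumes "a \<ge> 2" "b \<ge> 2" "quad_poly (of_nat a :: 'a::field_char_0) = quad_poly (of_nat b)"
  shows "a = b"
proof -
  have "coeff_m (of_nat a :: 'a) = coeff_m (of_nat b)"
    using assms(3) by (auto simp: quad_poly_coeffs)
  then have "(of_int (int a ^ 4 - 2 * int a ^ 2) :: 'a) = of_int (int b ^ 4 - 2 * int b ^ 2)"
    by (simp add: coeff_m_def algebra_simps)
  then have "int a ^ 4 - 2 * int a ^ 2 = int b ^ 4 - 2 * int b ^ 2"
    by (simp only: of_int_eq_iff)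
  then have "((int a)^2 - (int b)^2) * ((int a)^2 + (int b)^2 - 2) = 0"
    by Groebner_Basis.algebra
  moreover have "(int a)^2 \<ge> 2^2" "(int b)^2 \<ge> 2^2"
    using assms by (intro power_mono; simp)+
  ultimately have "(int a)^2 = (int b)^2" by auto
  then show ?thesis by simp
qed

text \<open>
  The infinitely many polynomials come from the natural numbers congruent to 2 modulo 3: they exceed
  \<open>sqrt 2\<close> under every real embedding and lie outside \<open>P\<close>.  What remains is the existence of
  a real embedding, and this is where the field has to be totally real.
\<close>

theorem corollary3p7:
  fixes P :: "'a::field_char_0 set"
  assumes "number_field TYPE('a)"
    and "totally_real TYPE('a)"
    and "primeideal P (ring_of_integers :: 'a ring)"
    and "lies_over P 3"
    and "has_residue_degree P 1"
  shows "(\<forall>\<sigma> :: 'a \<Rightarrow> real. field_embedding \<sigma> \<longrightarrow>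
           (\<forall>k \<in> carrier (ring_of_integers :: 'a ring).
              \<bar>\<sigma> k\<bar> > sqrt 2 \<and> \<not> ideal_dvd P (PIdl\<^bsub>ring_of_integers\<^esub> k) \<longrightarrow>
              newly_reducible_iterate 3 (quad_poly k)))
         \<and> in_N_infinity TYPE('a) 2 3"
proof (intro conjI allI impI ballI)
  fix \<sigma> :: "'a \<Rightarrow> real" and k :: 'a
  assume \<sigma>: "field_embedding \<sigma>" and "k \<in> carrier ring_of_integers"
    and k: "\<bar>\<sigma> k\<bar> > sqrt 2 \<and> \<not> ideal_dvd P (PIdl\<^bsub>ring_of_integers\<^esub> k)"
  then have "algebraic_int k" by simp
  then show "newly_reducible_iterate 3 (quad_poly k)"
    using quad_poly_newly_reducible[OF assms(3-5) \<sigma>] k not_ideal_dvd_principal_iff[OF assms(3)]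
    by blast
next
  obtain \<sigma> :: "'a \<Rightarrow> real" where \<sigma>: "field_embedding \<sigma>"
    using totally_real_number_field_real_embedding[OF assms(1,2)] .
  define g :: "nat \<Rightarrow> 'a poly" where "g n = quad_poly (of_nat (3 * n + 2))" for n
  have "inj g"
  proof (rule injI)
    fix a b assume "g a = g b"
    then have "3 * a + 2 = 3 * b + 2"
      unfolding g_def by (intro quad_poly_of_nat_inj) simp_all
    then show "a = b" by simp
  qed
  moreover have "Polynomial.degree (g n) = 2 \<and> newly_reducible_iterate 3 (g n)" for n
  proof
    show "Polynomial.degree (g n) = 2"
      by (simp add: g_def quad_poly_coeffs)
    have "sqrt 2 < 2"
      by (rule real_less_lsqrt) simp_all
    then have gt: "\<bar>\<sigma> (of_nat (3 * n + 2))\<bar> > sqrt 2"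
      unfolding field_embedding_of_nat[OF \<sigma>] by simp
    have "\<not> 3 dvd int (3 * n + 2)" by presburger
    then have "of_int (int (3 * n + 2)) \<notin> P"
      using assms(4) unfolding lies_over_def by blast
    then have "of_nat (3 * n + 2) \<notin> P"
      by (simp only: of_int_of_nat_eq not_False_eq_True)
    then show "newly_reducible_iterate 3 (g n)"
      unfolding g_def using gt
      by (intro quad_poly_newly_reducible[OF assms(3-5) \<sigma>]) (simp_all only: algebraic_int_of_nat not_False_eq_True)
  qed
  ultimately show "in_N_infinity TYPE('a) 2 3"
    unfolding in_N_infinity_def
    by (intro infinite_super[OF _ range_inj_infinite[of g]]) auto
qed

end
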